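(* Let $T=T_n\langle\alpha;\beta\rangle$ with $\alpha=\{i_1<\cdots<i_{k_1}\}$ and $\beta=\{j_1<\cdots<j_{k_2}\}$, and let $i,j\in[n]$ be integers with $i<j$. Then $i$ and $j$ are adjacent in $\mathrm{RG}(T)$ if and only if at least one of the following is true: (1) $j-i=i_t-i_s$ for some $i_s\in\alpha\cap[i-1]$ and $i_t\in\alpha\cap[j-1]$ with $s<t$; (2) $j-i=j_q-j_p$ for some $j_q\in\beta\cap[n-i]$ and $j_p\in\beta\cap[n-j]$ with $p<q$; (3) $j-i=i_t+j_q$ for some $i_t\in\alpha$ and $j_q\in\beta$.
   Context: Write $[m]=\{1,\dots,m\}$ (with $[0]=\emptyset$). For disjoint subsets $\alpha,\beta\subseteq[n-1]$, not both empty, $T_n\langle\alpha;\beta\rangle$ denotes the $n\times n$ $(0,1)$-matrix $(t_{u,v})$ with $t_{u,v}=1$ if and only if $u-v\in\alpha$ or $v-u\in\beta$. The row graph $\mathrm{RG}(T)$ of an $n\times n$ $(0,1)$-matrix $T=(t_{u,v})$ is the simple graph with vertex set $[n]$ in which two distinct vertices $u,v$ are adjacent if and only if $t_{u,k}=t_{v,k}=1$ for some $k\in[n]$. *)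

theory Defs
  imports "Jordan_Normal_Form.Matrix" "Graph_Theory.Pair_Digraph"
begin

text \<open>Rows and columns of a matrix are numbered from 1 in this development, but from 0 in the
  type \<^typ>\<open>'a mat\<close>.\<close>

definition entry :: "'a mat \<Rightarrow> nat \<Rightarrow> nat \<Rightarrow> 'a" where
  "entry A u v = A $$ (u - 1, v - 1)"

text \<open>The matrix \<open>T\<^sub>n\<langle>\<alpha>;\<beta>\<rangle>\<close>. Differences are taken in \<^typ>\<open>int\<close> to avoid
  truncation; the shift of the indices by one does not affect them.\<close>

definition toeplitz01 :: "nat \<Rightarrow> nat set \<Rightarrow> nat set \<Rightarrow> int mat" where
  "toeplitz01 n \<alpha> \<beta> =
     mat n n (\<lambda>(u, v). if int u - int v \<in> int ` \<alpha> \<or> int v - int u \<in> int ` \<beta> then 1 else 0)"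

text \<open>Simple graphs are rendered as in \<open>Graph_Theory\<close>: loop-free symmetric digraphs without
  parallel arcs, so that adjacency is the relation \<^const>\<open>dominates\<close>.\<close>

definition row_graph :: "int mat \<Rightarrow> nat pair_pre_digraph" where
  "row_graph A =
     \<lparr> pverts = {1..dim_row A},
       parcs = {(u, v). u \<in> {1..dim_row A} \<and> v \<in> {1..dim_row A} \<and> u \<noteq> v \<and>
                  (\<exists>k\<in>{1..dim_col A}. entry A u k = 1 \<and> entry A v k = 1)} \<rparr>"

lemma entry_toeplitz01:
  assumes "u \<in> {1..n}" "v \<in> {1..n}"
  shows "entry (toeplitz01 n \<alpha> \<beta>) u v =
    (if int u - int v \<in> int ` \<alpha> \<or> int v - int u \<in> int ` \<beta> then 1 else 0)"
proof -
  have "u - 1 < n" "v - 1 < n" "int (u - 1) = int u - 1" "int (v - 1) = int v - 1"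
    using assms by auto
  then show ?thesis
    by (simp add: entry_def toeplitz01_def)
qed

lemma pair_graph_row_graph: "pair_graph (row_graph A)"
proof
  show "finite (pverts (row_graph A))"
    by (simp add: row_graph_def)
  show "finite (parcs (row_graph A))"
    by (rule finite_subset[of _ "{1..dim_row A} \<times> {1..dim_row A}"]) (auto simp: row_graph_def)
  show "symmetric (with_proj (row_graph A))"
    unfolding symmetric_def with_proj_simps by (auto simp: sym_def row_graph_def)
qed (auto simp: row_graph_def)

end

theory Submission
  imports Defs
begin

text \<open>Rows \<open>i < j\<close> are adjacent exactly when some column \<open>k\<close> carries a 1 in both. A 1 of row \<open>u\<close> in
  column \<open>k\<close> lies either at distance \<open>u - k \<in> \<alpha>\<close> to the left of the diagonal or at distance
  \<open>k - u \<in> \<beta>\<close> to the right of it, and the three alternatives of the theorem are the three possible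
  positions of \<open>k\<close>: left of both diagonal entries, right of both, or strictly between them. The
  remaining combination, left of \<open>i\<close> and right of \<open>j\<close>, would force \<open>j < k < i\<close>. In each case \<open>k\<close> is
  determined by one distance, and the bounds on the distances say that \<open>k\<close> is a column of the matrix.

  This gives a criterion in terms of the elements of \<open>\<alpha>\<close> and \<open>\<beta>\<close>
  (\<open>dominates_row_graph_toeplitz01_iff\<close>). Since the enumerations are strictly increasing, the
  comparison of indices agrees with the comparison of elements
  (\<open>strict_mono_on_bex_less_image_iff\<close>), which turns the criterion into the indexed one.\<close>

lemma dominates_row_graph_iff:
  "u \<rightarrow>\<^bsub>with_proj (row_graph A)\<^esub> v \<longleftrightarrow>
    u \<in> {1..dim_row A} \<and> v \<in> {1..dim_row A} \<and> u \<noteq> v \<and>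
    (\<exists>k\<in>{1..dim_col A}. entry A u k = 1 \<and> entry A v k = 1)"
  by (simp add: row_graph_def with_proj_simps)

text \<open>The differences of the matrix are integers; positivity of the elements of \<open>\<alpha>\<close> and \<open>\<beta>\<close> makes
  a 1 fall strictly on one side of the diagonal, after which natural-number arithmetic suffices.\<close>

lemma entry_toeplitz01_eq_1_iff:
  assumes "\<alpha> \<subseteq> {1..}" "\<beta> \<subseteq> {1..}" "u \<in> {1..n}" "k \<in> {1..n}"
  shows "entry (toeplitz01 n \<alpha> \<beta>) u k = 1 \<longleftrightarrow> (k < u \<and> u - k \<in> \<alpha>) \<or> (u < k \<and> k - u \<in> \<beta>)"
proof -
  have "int p - int q \<in> int ` S \<longleftrightarrow> q < p \<and> p - q \<in> S" if "S \<subseteq> {1..}" for p q and S :: "nat set"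
  proof
    assume "int p - int q \<in> int ` S"
    then obtain x where x: "x \<in> S" "int p - int q = int x" by auto
    moreover have "1 \<le> x" using x(1) that by auto
    moreover have "p - q = x" using x(2) by linarith
    ultimately show "q < p \<and> p - q \<in> S" by auto
  next
    assume "q < p \<and> p - q \<in> S"
    then show "int p - int q \<in> int ` S" by (intro image_eqI[where x = "p - q"]) auto
  qed
  then show ?thesis
    using assms by (simp add: entry_toeplitz01)
qed

text \<open>The criterion on the level of elements: the smaller of the two distances in a one-sided
  case, \<open>x\<close> from \<open>i\<close> or \<open>y\<close> from \<open>j\<close>, gives the common column \<open>i - x\<close> or \<open>j + y\<close>, and its bound
  keeps that column inside the matrix. A column between \<open>i\<close> and \<open>j\<close> is inside anyway.\<close>

lemma dominates_row_graph_toeplitz01_iff: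
  assumes pos: "\<alpha> \<subseteq> {1..}" "\<beta> \<subseteq> {1..}" and ij: "i \<in> {1..n}" "j \<in> {1..n}" "i < j"
  shows "i \<rightarrow>\<^bsub>with_proj (row_graph (toeplitz01 n \<alpha> \<beta>))\<^esub> j \<longleftrightarrow>
    (\<exists>x\<in>\<alpha>. x < i \<and> x + (j - i) \<in> \<alpha>) \<or>
    (\<exists>y\<in>\<beta>. y \<le> n - j \<and> y + (j - i) \<in> \<beta>) \<or>
    (\<exists>x\<in>\<alpha>. \<exists>y\<in>\<beta>. j - i = x + y)"
    (is "_ \<longleftrightarrow> ?left \<or> ?right \<or> ?between")
proof -
  have dim: "dim_row (toeplitz01 n \<alpha> \<beta>) = n" "dim_col (toeplitz01 n \<alpha> \<beta>) = n"
    by (simp_all add: toeplitz01_def)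
  let ?one = "\<lambda>u k. (k < u \<and> u - k \<in> \<alpha>) \<or> (u < k \<and> k - u \<in> \<beta>)"
  have adj: "i \<rightarrow>\<^bsub>with_proj (row_graph (toeplitz01 n \<alpha> \<beta>))\<^esub> j \<longleftrightarrow>
      (\<exists>k\<in>{1..n}. ?one i k \<and> ?one j k)"
    unfolding dominates_row_graph_iff dim using ij
    by (auto simp: entry_toeplitz01_eq_1_iff[OF pos])
  show ?thesis
    unfolding adj
  proof
    assume "\<exists>k\<in>{1..n}. ?one i k \<and> ?one j k"
    then obtain k where k: "1 \<le> k" "k \<le> n" "?one i k" "?one j k"
      unfolding atLeastAtMost_iff Bex_def by blast
    then consider (left) "k < i" "i - k \<in> \<alpha>" "j - k \<in> \<alpha>"
      | (right) "j < k" "k - i \<in> \<beta>" "k - j \<in> \<beta>"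
      | (between) "i < k" "k < j" "k - i \<in> \<beta>" "j - k \<in> \<alpha>"
      using ij(3) by fastforce
    then show "?left \<or> ?right \<or> ?between"
    proof cases
      case left
      have "(i - k) + (j - i) = j - k" "i - k < i" using left(1) k(1) ij(3) by auto
      then have ?left using left by metis
      then show ?thesis by blast
    next
      case right
      have "(k - j) + (j - i) = k - i" "k - j \<le> n - j" using right(1) k(2) ij(3) by auto
      then have ?right using right by metis
      then show ?thesis by blast
    next
      case between
      have "j - i = (j - k) + (k - i)" using between(1,2) by auto
      then have ?between using between by blast
      then show ?thesis by blast
    qed
  next
    assume "?left \<or> ?right \<or> ?between"
    then show "\<exists>k\<in>{1..n}. ?one i k \<and> ?one j k"
    proof (elim disjE)
      assume ?left
      then obtain x where x: "x \<in> \<alpha>" "x < i" "x + (j - i) \<in> \<alpha>" by blast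
      have "1 \<le> x" using x(1) pos by auto
      moreover have "i - (i - x) = x" "j - (i - x) = x + (j - i)" using x(2) ij(3) by auto
      ultimately show ?thesis
        using x ij by (intro bexI[where x = "i - x"]) auto
    next
      assume ?right
      then obtain y where y: "y \<in> \<beta>" "y \<le> n - j" "y + (j - i) \<in> \<beta>" by blast
      have "1 \<le> y" using y(1) pos by auto
      moreover have "j + y - j = y" "j + y - i = y + (j - i)" using ij(3) by auto
      ultimately show ?thesis
        using y ij by (intro bexI[where x = "j + y"]) auto
    next
      assume ?between
      then obtain x y where xy: "x \<in> \<alpha>" "y \<in> \<beta>" "j - i = x + y" by blast
      have "1 \<le> x" "1 \<le> y" using xy pos by auto
      moreover have "i + y - i = y" "j - (i + y) = x" using xy(3) by auto
      ultimately show ?thesis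
        using xy ij by (intro bexI[where x = "i + y"]) auto
    qed
  qed
qed

lemma strict_mono_on_bex_less_image_iff:
  fixes f :: "'a::linorder \<Rightarrow> 'b::linorder"
  assumes "strict_mono_on K f"
  shows "(\<exists>s\<in>K. \<exists>t\<in>K. s < t \<and> R (f s) (f t)) \<longleftrightarrow> (\<exists>x\<in>f ` K. \<exists>y\<in>f ` K. x < y \<and> R x y)"
  using strict_mono_on_less[OF assms] by auto

text \<open>For a fixed positive difference \<open>d\<close> the larger element is the smaller one plus \<open>d\<close>, so its
  bound \<open>N\<close> follows from the bound \<open>M\<close> on the smaller one as soon as \<open>N = M + d\<close>. Both one-sided
  alternatives have this form, with \<open>(M, N) = (i - 1, j - 1)\<close> and \<open>(M, N) = (n - j, n - i)\<close>.\<close>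

lemma bex_index_pair_with_difference_iff:
  fixes f :: "'a::linorder \<Rightarrow> nat" and d M N :: nat
  assumes mono: "strict_mono_on K f" and pos: "f ` K \<subseteq> {1..}" and "0 < d" "N = M + d"
  shows "(\<exists>s\<in>K. \<exists>t\<in>K. s < t \<and> f s \<in> f ` K \<inter> {1..M} \<and> f t \<in> f ` K \<inter> {1..N} \<and>
            int d = int (f t) - int (f s)) \<longleftrightarrow>
         (\<exists>x\<in>f ` K. x \<le> M \<and> x + d \<in> f ` K)"
    (is "?indices \<longleftrightarrow> ?elements")
proof -
  have "?indices \<longleftrightarrow> (\<exists>x\<in>f ` K. \<exists>y\<in>f ` K. x < y \<and> x \<in> f ` K \<inter> {1..M} \<and>
      y \<in> f ` K \<inter> {1..N} \<and> int d = int y - int x)"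
    by (rule strict_mono_on_bex_less_image_iff[OF mono])
  also have "\<dots> \<longleftrightarrow> ?elements"
  proof
    assume "\<exists>x\<in>f ` K. \<exists>y\<in>f ` K. x < y \<and> x \<in> f ` K \<inter> {1..M} \<and>
      y \<in> f ` K \<inter> {1..N} \<and> int d = int y - int x"
    then obtain x y where "x \<in> f ` K" "y \<in> f ` K" "x \<le> M" "int d = int y - int x" by auto
    moreover from this have "y = x + d" by linarith
    ultimately show ?elements by blast
  next
    assume ?elements
    then obtain x where x: "x \<in> f ` K" "x \<le> M" "x + d \<in> f ` K" by blast
    have "1 \<le> x" using x(1) pos by blast
    then show "\<exists>x\<in>f ` K. \<exists>y\<in>f ` K. x < y \<and> x \<in> f ` K \<inter> {1..M} \<and>
        y \<in> f ` K \<inter> {1..N} \<and> int d = int y - int x"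
      using x assms(3,4) by (intro bexI[OF _ x(1)] bexI[OF _ x(3)]) auto
  qed
  finally show ?thesis .
qed

theorem theorem2p1:
  fixes n k1 k2 i j :: nat
    and \<alpha> \<beta> :: "nat set"
    and a b :: "nat \<Rightarrow> nat"
  assumes "\<alpha> \<subseteq> {1..n - 1}" and "\<beta> \<subseteq> {1..n - 1}"
    and "\<alpha> \<inter> \<beta> = {}" and "\<not> (\<alpha> = {} \<and> \<beta> = {})"
    and "\<alpha> = a ` {1..k1}" and "strict_mono_on {1..k1} a"
    and "\<beta> = b ` {1..k2}" and "strict_mono_on {1..k2} b"
    and "i \<in> {1..n}" and "j \<in> {1..n}" and "i < j"
  shows "i \<rightarrow>\<^bsub>with_proj (row_graph (toeplitz01 n \<alpha> \<beta>))\<^esub> j \<longleftrightarrow>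
    (\<exists>s\<in>{1..k1}. \<exists>t\<in>{1..k1}. s < t \<and> a s \<in> \<alpha> \<inter> {1..i - 1} \<and> a t \<in> \<alpha> \<inter> {1..j - 1} \<and>
       int j - int i = int (a t) - int (a s)) \<or>
    (\<exists>p\<in>{1..k2}. \<exists>q\<in>{1..k2}. p < q \<and> b q \<in> \<beta> \<inter> {1..n - i} \<and> b p \<in> \<beta> \<inter> {1..n - j} \<and>
       int j - int i = int (b q) - int (b p)) \<or>
    (\<exists>t\<in>{1..k1}. \<exists>q\<in>{1..k2}. a t \<in> \<alpha> \<and> b q \<in> \<beta> \<and>
       int j - int i = int (a t) + int (b q))"
proof -
  have pos: "\<alpha> \<subseteq> {1..}" "\<beta> \<subseteq> {1..}" using assms(1,2) by auto
  have d: "int j - int i = int (j - i)" "0 < j - i" using \<open>i < j\<close> by auto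
  have "j - 1 = (i - 1) + (j - i)" using assms(9-11) by auto
  from bex_index_pair_with_difference_iff[OF assms(6) _ d(2) this]
  have left: "(\<exists>s\<in>{1..k1}. \<exists>t\<in>{1..k1}. s < t \<and> a s \<in> \<alpha> \<inter> {1..i - 1} \<and>
      a t \<in> \<alpha> \<inter> {1..j - 1} \<and> int j - int i = int (a t) - int (a s)) \<longleftrightarrow>
      (\<exists>x\<in>\<alpha>. x \<le> i - 1 \<and> x + (j - i) \<in> \<alpha>)"
    using pos(1) unfolding assms(5) d(1) by blast
  have "n - i = (n - j) + (j - i)" using assms(9-11) by auto
  from bex_index_pair_with_difference_iff[OF assms(8) _ d(2) this]
  have right: "(\<exists>p\<in>{1..k2}. \<exists>q\<in>{1..k2}. p < q \<and> b q \<in> \<beta> \<inter> {1..n - i} \<and>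
      b p \<in> \<beta> \<inter> {1..n - j} \<and> int j - int i = int (b q) - int (b p)) \<longleftrightarrow>
      (\<exists>y\<in>\<beta>. y \<le> n - j \<and> y + (j - i) \<in> \<beta>)"
    using pos(2) unfolding assms(7) d(1) by (simp only: conj_ac)
  have between: "(\<exists>t\<in>{1..k1}. \<exists>q\<in>{1..k2}. a t \<in> \<alpha> \<and> b q \<in> \<beta> \<and>
      int j - int i = int (a t) + int (b q)) \<longleftrightarrow> (\<exists>x\<in>\<alpha>. \<exists>y\<in>\<beta>. j - i = x + y)"
    unfolding assms(5,7) d(1) of_nat_add[symmetric] of_nat_eq_iff by blast
  have "x < i \<longleftrightarrow> x \<le> i - 1" for x using assms(9) by auto
  then show ?thesis
    unfolding left right between
    using dominates_row_graph_toeplitz01_iff[OF pos assms(9-11)] by simp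
qed

end
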